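(* Let $G$ be an infinite abelian group and $h$ a positive integer. If for every integer $1\leq m\leq h$ the quotient group $G/m\cdot G$ is finite, then \[X_G(h)\leq h^2+h\cdot\max_{1\leq m\leq h}\Omega(|G/m\cdot G|)+h-1.\]
   Context: $m\cdot G=\{mg:g\in G\}$. For $n=p_1^{\alpha_1}\cdots p_k^{\alpha_k}$ (prime factorization), $\Omega(n)=\alpha_1+\cdots+\alpha_k$. For $A\subset G$ and a positive integer $h$, $hA$ is the set of sums of $h$ not necessarily distinct elements of $A$; $A\sim B$ means finite symmetric difference. $\operatorname{ord}^*_G(A)$ is the least $k$ with $kA\sim G$ ($\infty$ if none). $A$ is a basis if $\operatorname{ord}^*_G(A)<\infty$. For a basis $A$, $a\in A$ is regular if $A\setminus\{a\}$ is still a basis; $A^*$ is the set of regular elements. $X_G(h)=\sup\{\operatorname{ord}^*_G(A\setminus\{a\}) : A\subset G,\ hA\sim G,\ a\in A^*\}$. *)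

theory Defs
  imports "HOL-Algebra.Coset" "HOL-Algebra.FiniteProduct" "HOL-Library.Extended_Nat" "HOL-Computational_Algebra.Primes"
begin

text \<open>
  The ambient abelian group, written additively in the mathematics, is a
  \<^locale>\<open>comm_group\<close>, hence multiplicative here: the multiple \<open>m g\<close> is
  \<open>g [^] m\<close>, and a sum of \<open>h\<close> elements is a \<^const>\<open>finprod\<close>.
\<close>

definition multiples :: "('a, 'b) monoid_scheme \<Rightarrow> nat \<Rightarrow> 'a set" where
  "multiples G m = {g [^]\<^bsub>G\<^esub> m | g. g \<in> carrier G}"

definition big_omega :: "nat \<Rightarrow> nat" where
  "big_omega n = (\<Sum>p\<in>prime_factors n. multiplicity p n)"

definition sumset :: "('a, 'b) monoid_scheme \<Rightarrow> nat \<Rightarrow> 'a set \<Rightarrow> 'a set" where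
  "sumset G h A = {finprod G f {..<h} | f. f \<in> {..<h} \<rightarrow> A}"

definition almost_eq :: "'a set \<Rightarrow> 'a set \<Rightarrow> bool" (infix "\<simeq>" 50) where
  "A \<simeq> B \<longleftrightarrow> finite (sym_diff A B)"

definition ord_star :: "('a, 'b) monoid_scheme \<Rightarrow> 'a set \<Rightarrow> enat" where
  "ord_star G A =
     (if \<exists>k\<ge>1. sumset G k A \<simeq> carrier G
      then enat (LEAST k. k \<ge> 1 \<and> sumset G k A \<simeq> carrier G)
      else \<infinity>)"

definition additive_basis :: "('a, 'b) monoid_scheme \<Rightarrow> 'a set \<Rightarrow> bool" where
  "additive_basis G A \<longleftrightarrow> A \<subseteq> carrier G \<and> ord_star G A < \<infinity>"

definition regular_elements :: "('a, 'b) monoid_scheme \<Rightarrow> 'a set \<Rightarrow> 'a set" where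
  "regular_elements G A = {a \<in> A. additive_basis G (A - {a})}"

definition X_fun :: "('a, 'b) monoid_scheme \<Rightarrow> nat \<Rightarrow> enat" where
  "X_fun G h = Sup {ord_star G (A - {a}) | A a.
     A \<subseteq> carrier G \<and> sumset G h A \<simeq> carrier G \<and> a \<in> regular_elements G A}"

end

theory Submission
  imports Defs
begin

text \<open>
  After a translation the removed element is the identity \<open>0\<close> (in additive notation); put
  \<open>B = A - {0}\<close>, so that almost every element of \<open>G\<close> is a sum of \<open>i\<close> elements of \<open>B\<close> for some
  \<open>1 \<le> i \<le> h\<close>. Comparing these lengths along an arithmetic progression with difference in \<open>B\<close>
  gives an element \<open>c\<close> that is both a sum of \<open>s\<close> and of \<open>s + m\<close> elements of \<open>B\<close>, where
  \<open>1 \<le> m \<le> h\<close> and \<open>s + m \<le> h + 1\<close>. Since \<open>G / m G\<close> has exponent \<open>m\<close>, each of its classes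
  contains a sum \<open>f\<close> of \<open>r = (m - 1) \<Omega>(|G / m G|)\<close> elements of \<open>B\<close>. Hence every \<open>x\<close> has the
  form \<open>f + m z + (h - 1) c\<close>, where for almost all \<open>x\<close> the element \<open>z\<close> is a sum of \<open>i \<le> h\<close>
  elements of \<open>B\<close>. The length \<open>m i\<close> of \<open>m z\<close> is a multiple of \<open>m\<close>, so using the longer
  representation for \<open>h - i\<close> of the copies of \<open>c\<close> makes the total length equal to
  \<open>r + m h + (h - 1) s\<close>, whatever \<open>i\<close> is.
\<close>

section \<open>Omega and cofinite sets\<close>

lemma big_omega_eq_size: "big_omega n = size (prime_factorization n)"
proof -
  have "multiplicity p n = count (prime_factorization n) p" if "p \<in> prime_factors n" for p
    using that by (simp add: count_prime_factorization in_prime_factors_iff)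
  then show ?thesis
    unfolding big_omega_def size_multiset_overloaded_eq by simp
qed

lemma big_omega_mult:
  assumes "m > 0" "n > 0"
  shows "big_omega (m * n) = big_omega m + big_omega n"
  using assms by (simp add: big_omega_eq_size prime_factorization_mult)

lemma big_omega_pos:
  assumes "n > 1"
  shows "big_omega n > 0"
  using assms by (simp add: big_omega_eq_size prime_factorization_empty_iff flip: neq0_conv)

lemma almost_eq_superset_iff:
  assumes "S \<subseteq> T"
  shows "S \<simeq> T \<longleftrightarrow> finite (T - S)"
  using assms by (simp add: almost_eq_def Diff_eq_empty_iff[THEN iffD2])

lemma ord_star_le:
  assumes "k \<ge> 1" "sumset G k A \<simeq> carrier G"
  shows "ord_star G A \<le> enat k"
  using assms Least_le[of "\<lambda>k. k \<ge> 1 \<and> sumset G k A \<simeq> carrier G" k]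
  by (auto simp: ord_star_def)

context comm_group
begin

section \<open>Sums of a fixed length\<close>

lemma sumset_0 [simp]: "sumset G 0 A = {\<one>}"
  by (auto simp: sumset_def)

lemma sumset_Suc:
  assumes "A \<subseteq> carrier G"
  shows "sumset G (Suc k) A = {a \<otimes> x | a x. a \<in> A \<and> x \<in> sumset G k A}"
proof (intro equalityI subsetI)
  fix y assume "y \<in> sumset G (Suc k) A"
  then obtain f where f: "f \<in> {..<Suc k} \<rightarrow> A" "y = finprod G f {..<Suc k}"
    by (auto simp: sumset_def)
  have fk: "f \<in> {..<k} \<rightarrow> A" "f k \<in> A"
    using f(1) by auto
  have "y = f k \<otimes> finprod G f {..<k}"
    unfolding f(2) lessThan_Suc
    by (rule finprod_insert) (use fk assms in auto)
  then show "y \<in> {a \<otimes> x | a x. a \<in> A \<and> x \<in> sumset G k A}"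
    using fk by (auto simp: sumset_def)
next
  fix y assume "y \<in> {a \<otimes> x | a x. a \<in> A \<and> x \<in> sumset G k A}"
  then obtain a f where f: "f \<in> {..<k} \<rightarrow> A" and a: "a \<in> A"
    and y: "y = a \<otimes> finprod G f {..<k}"
    by (auto simp: sumset_def)
  define g where "g = f(k := a)"
  have g: "g \<in> {..<Suc k} \<rightarrow> A"
    using f a by (auto simp: g_def less_Suc_eq)
  have "finprod G g {..<Suc k} = g k \<otimes> finprod G g {..<k}"
    unfolding lessThan_Suc by (rule finprod_insert) (use g assms in auto)
  also have "finprod G g {..<k} = finprod G f {..<k}"
    by (rule finprod_cong') (use f assms in \<open>auto simp: g_def\<close>)
  finally have "y = finprod G g {..<Suc k}"
    by (simp only: y) (simp add: g_def)
  then show "y \<in> sumset G (Suc k) A"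
    using g by (auto simp: sumset_def)
qed

lemma sumset_subset_subgroup:
  assumes "subgroup H G" "A \<subseteq> H"
  shows "sumset G k A \<subseteq> H"
proof -
  have "A \<subseteq> carrier G"
    using assms subgroup.subset by blast
  then show ?thesis
    using assms
    by (induction k)
      (auto simp: sumset_Suc subgroup.one_closed intro!: subgroup.m_closed[OF assms(1)])
qed

lemma sumset_subset_carrier:
  assumes "A \<subseteq> carrier G"
  shows "sumset G k A \<subseteq> carrier G"
  by (rule sumset_subset_subgroup[OF subgroup_self assms])

lemma sumset_1:
  assumes "A \<subseteq> carrier G"
  shows "sumset G (Suc 0) A = A"
  using assms by (force simp: sumset_Suc)

lemma sumset_add:
  assumes "A \<subseteq> carrier G" "x \<in> sumset G i A" "y \<in> sumset G j A"
  shows "x \<otimes> y \<in> sumset G (i + j) A"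
  using assms(2)
proof (induction i arbitrary: x)
  case 0
  then show ?case
    using assms sumset_subset_carrier[OF assms(1), of j] by (auto simp: subset_iff)
next
  case (Suc i)
  then obtain a z where az: "a \<in> A" "z \<in> sumset G i A" "x = a \<otimes> z"
    using assms(1) by (auto simp: sumset_Suc)
  have "x \<otimes> y = a \<otimes> (z \<otimes> y)"
    using az assms sumset_subset_carrier[OF assms(1)] by (subst az(3), intro m_assoc) auto
  then show ?case
    using Suc.IH[OF az(2)] az(1) assms(1) by (auto simp: sumset_Suc)
qed

lemma sumset_nat_pow:
  assumes "A \<subseteq> carrier G" "x \<in> sumset G i A"
  shows "x [^] (n::nat) \<in> sumset G (n * i) A"
proof (induction n)
  case (Suc n)
  then show ?case
    using sumset_add[OF assms(1) Suc assms(2)] by (simp add: add.commute)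
qed simp

text \<open>Write \<open>t\<close> of the \<open>n\<close> copies of \<open>c\<close> with length
  \<open>s + m\<close> and the others with length \<open>s\<close>. Varying \<open>t\<close> changes
  the total length in steps of \<open>m\<close>.\<close>

lemma nat_pow_mem_sumset_interpolate:
  assumes "A \<subseteq> carrier G" "c \<in> sumset G s A" "c \<in> sumset G (s + m) A" "t \<le> n"
  shows "c [^] (n::nat) \<in> sumset G (n * s + t * m) A"
proof -
  have c: "c \<in> carrier G"
    using assms sumset_subset_carrier by blast
  have "c [^] t \<otimes> c [^] (n - t) \<in> sumset G (t * (s + m) + (n - t) * s) A"
    using assms by (intro sumset_add sumset_nat_pow)
  moreover have "c [^] t \<otimes> c [^] (n - t) = c [^] n"
    using c assms(4) by (simp add: nat_pow_mult)
  moreover have "t * (s + m) + (n - t) * s = n * s + t * m"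
  proof -
    obtain u where "n = t + u"
      using assms(4) le_Suc_ex by blast
    then show ?thesis
      by (simp add: algebra_simps)
  qed
  ultimately show ?thesis
    by simp
qed

text \<open>Pad with \<open>j - i\<close> identity factors.\<close>

lemma sumset_mono:
  assumes "A \<subseteq> carrier G" "\<one> \<in> A" "i \<le> j"
  shows "sumset G i A \<subseteq> sumset G j A"
proof
  fix x assume x: "x \<in> sumset G i A"
  have "\<one> [^] (j - i) \<in> sumset G ((j - i) * 1) A"
    by (rule sumset_nat_pow) (use assms sumset_1 in auto)
  from sumset_add[OF assms(1) x this] show "x \<in> sumset G j A"
    using assms x sumset_subset_carrier by (auto simp: subset_iff)
qed

section \<open>Translations and removal of the identity\<close>

lemma sumset_translate:
  assumes "A \<subseteq> carrier G" "c \<in> carrier G"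
  shows "sumset G k ((\<otimes>) c ` A) = (\<otimes>) (c [^] k) ` sumset G k A"
proof (induction k)
  case (Suc k)
  have cA: "(\<otimes>) c ` A \<subseteq> carrier G"
    using assms by auto
  have eq: "c \<otimes> a \<otimes> (c [^] k \<otimes> x) = c [^] Suc k \<otimes> (a \<otimes> x)"
    if "a \<in> A" "x \<in> sumset G k A" for a x
  proof -
    have "a \<in> carrier G" "x \<in> carrier G"
      using that assms sumset_subset_carrier by auto
    then show ?thesis
      using assms(2) by (simp add: m_ac)
  qed
  show ?case
    unfolding sumset_Suc[OF cA] sumset_Suc[OF assms(1)] Suc
    using eq by (auto simp: image_iff) metis
qed (use assms in auto)

lemma translate_almost_eq_carrier_iff:
  assumes "S \<subseteq> carrier G" "c \<in> carrier G"
  shows "(\<otimes>) c ` S \<simeq> carrier G \<longleftrightarrow> S \<simeq> carrier G"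
proof -
  have inj: "inj_on ((\<otimes>) c) (carrier G)"
    using assms by (simp add: inj_on_def)
  have surj: "(\<otimes>) c ` carrier G = carrier G"
    using assms(2) surj_const_mult by auto
  have "carrier G - (\<otimes>) c ` S = (\<otimes>) c ` (carrier G - S)"
    using inj_on_image_set_diff[OF inj, of "carrier G" S] assms(1) surj by auto
  moreover have "inj_on ((\<otimes>) c) (carrier G - S)"
    using inj by (rule inj_on_subset) auto
  ultimately have "finite (carrier G - (\<otimes>) c ` S) \<longleftrightarrow> finite (carrier G - S)"
    by (simp add: finite_image_iff)
  moreover have "(\<otimes>) c ` S \<subseteq> carrier G"
    using assms by auto
  ultimately show ?thesis
    using assms(1) by (simp add: almost_eq_superset_iff)
qed

lemma sumset_translate_almost_eq_iff:
  assumes "A \<subseteq> carrier G" "c \<in> carrier G"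
  shows "sumset G k ((\<otimes>) c ` A) \<simeq> carrier G \<longleftrightarrow> sumset G k A \<simeq> carrier G"
  using assms
  by (simp add: sumset_translate translate_almost_eq_carrier_iff sumset_subset_carrier)

lemma ord_star_translate:
  assumes "A \<subseteq> carrier G" "c \<in> carrier G"
  shows "ord_star G ((\<otimes>) c ` A) = ord_star G A"
  by (simp add: ord_star_def sumset_translate_almost_eq_iff[OF assms])

text \<open>Dropping the identity factors costs control of the length: only the upper bound
  \<open>k\<close> survives. Restoring one common length is the task of the whole proof.\<close>

lemma sumset_insert_one:
  assumes "B \<subseteq> carrier G" "x \<in> sumset G k (insert \<one> B)"
  obtains i where "i \<le> k" "x \<in> sumset G i B"
proof -
  have "\<exists>i\<le>k. x \<in> sumset G i B"
    using assms(2)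
  proof (induction k arbitrary: x)
    case (Suc k)
    then obtain a y where ay: "a \<in> insert \<one> B" "y \<in> sumset G k (insert \<one> B)" "x = a \<otimes> y"
      using assms(1) by (auto simp: sumset_Suc)
    from Suc.IH[OF ay(2)] obtain i where i: "i \<le> k" "y \<in> sumset G i B"
      by blast
    have y: "y \<in> carrier G"
      using i(2) sumset_subset_carrier[OF assms(1)] by blast
    show ?case
    proof (cases "a \<in> B")
      case True
      then have "x \<in> sumset G (Suc i) B"
        using ay i assms(1) by (auto simp: sumset_Suc)
      then show ?thesis
        using i by (intro exI[of _ "Suc i"]) auto
    next
      case False
      then have "x = y"
        using ay y by auto
      then show ?thesis
        using i by (intro exI[of _ i]) auto
    qed
  qed simp
  then show ?thesis
    using that by blast
qed

section \<open>Finite groups of given exponent\<close>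

text \<open>Torsion makes natural exponents suffice, since \<open>d [^] ((m - 1) * e)\<close> is the
  inverse of \<open>d [^] e\<close>. Elements of the larger subgroup are thus reached by positive
  powers of \<open>d\<close>, as a sumset requires.\<close>

lemma subgroup_adjoin_torsion:
  assumes H: "subgroup H G" and d: "d \<in> carrier G" "d [^] (m::nat) = \<one>" "m \<ge> 1"
  shows "subgroup {x \<otimes> d [^] (e::nat) | x e. x \<in> H} G"
proof
  have Hc: "x \<in> carrier G" if "x \<in> H" for x
    using that H subgroup.subset by blast
  show "{x \<otimes> d [^] (e::nat) | x e. x \<in> H} \<subseteq> carrier G"
    using Hc d by auto
  show "\<one> \<in> {x \<otimes> d [^] (e::nat) | x e. x \<in> H}"
    using subgroup.one_closed[OF H] by (auto intro!: exI[of _ \<one>] exI[of _ "0::nat"])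
next
  have Hc: "x \<in> carrier G" if "x \<in> H" for x
    using that H subgroup.subset by blast
  fix u v assume "u \<in> {x \<otimes> d [^] (e::nat) | x e. x \<in> H}" "v \<in> {x \<otimes> d [^] (e::nat) | x e. x \<in> H}"
  then obtain x e y f where xy: "x \<in> H" "y \<in> H" "u = x \<otimes> d [^] (e::nat)" "v = y \<otimes> d [^] (f::nat)"
    by auto
  have "u \<otimes> v = (x \<otimes> y) \<otimes> d [^] (e + f)"
    using xy Hc d by (simp add: nat_pow_mult[symmetric] m_ac)
  then show "u \<otimes> v \<in> {x \<otimes> d [^] (e::nat) | x e. x \<in> H}"
    using subgroup.m_closed[OF H xy(1,2)] by blast
next
  have Hc: "x \<in> carrier G" if "x \<in> H" for x
    using that H subgroup.subset by blast
  fix u assume "u \<in> {x \<otimes> d [^] (e::nat) | x e. x \<in> H}"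
  then obtain x e where x: "x \<in> H" "u = x \<otimes> d [^] (e::nat)"
    by auto
  have "d [^] e \<otimes> d [^] ((m - 1) * e) = d [^] (m * e)"
    using d(1,3) by (cases m) (simp_all add: nat_pow_mult)
  also have "\<dots> = \<one>"
    using d by (simp add: nat_pow_pow[symmetric])
  finally have "inv (d [^] e) = d [^] ((m - 1) * e)"
    using d(1) by (metis inv_equality m_comm nat_pow_closed)
  then have "inv u = inv x \<otimes> d [^] ((m - 1) * e)"
    using x Hc d(1) by (simp add: inv_mult)
  then show "inv u \<in> {x \<otimes> d [^] (e::nat) | x e. x \<in> H}"
    using subgroup.m_inv_closed[OF H x(1)] by blast
qed

text \<open>By Lagrange the cardinality is multiplied by an index \<open>t > 1\<close>, which
  contributes at least one prime factor.\<close>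

lemma big_omega_card_subgroup_less:
  assumes fin: "finite (carrier G)" and H: "subgroup H G" and K: "subgroup K G" and "H \<subset> K"
  shows "big_omega (card H) < big_omega (card K)"
proof -
  interpret K: group "G\<lparr>carrier := K\<rparr>"
    using K by (rule subgroup_imp_group)
  have "subgroup H (G\<lparr>carrier := K\<rparr>)"
    using \<open>H \<subset> K\<close> H K subgroup_incl by blast
  from K.lagrange[OF this] obtain t where t: "card K = t * card H"
    by (auto simp: order_def intro: that[OF sym])
  have finK: "finite K"
    using fin K finite_subset subgroup.subset by blast
  then have pos: "card H > 0"
    using \<open>H \<subset> K\<close> finite_subset subgroup.one_closed[OF H] by (force simp: card_gt_0_iff)
  have "card H < card K"
    using finK \<open>H \<subset> K\<close> by (rule psubset_card_mono)
  then have "t > 1"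
    using t by (cases t) auto
  then show ?thesis
    using t pos big_omega_mult[of t "card H"] big_omega_pos[of t] by simp
qed

text \<open>Adjoining elements of \<open>D\<close> one at a time gives a chain of subgroups, each step of which
  costs at most \<open>m - 1\<close> factors and raises \<^const>\<open>big_omega\<close> of the cardinality.\<close>

lemma carrier_subset_sumset_of_exponent:
  assumes fin: "finite (carrier G)" and m: "m \<ge> 1"
    and exponent: "\<And>x. x \<in> carrier G \<Longrightarrow> x [^] (m::nat) = \<one>"
    and D: "D \<subseteq> carrier G" "\<one> \<in> D"
    and gen: "\<And>H. subgroup H G \<Longrightarrow> D \<subseteq> H \<Longrightarrow> H = carrier G"
  shows "carrier G \<subseteq> sumset G ((m - 1) * big_omega (order G)) D"
proof -
  have "carrier G \<subseteq> sumset G ((m - 1) * big_omega (order G)) D"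
    if "subgroup H G" "H \<subseteq> sumset G ((m - 1) * big_omega (card H)) D" for H
    using that
  proof (induction "order G - card H" arbitrary: H rule: less_induct)
    case less
    note H = less.prems(1)
    have Hc: "H \<subseteq> carrier G"
      using H subgroup.subset by blast
    show ?case
    proof (cases "D \<subseteq> H")
      case True
      then show ?thesis
        using gen[OF H] less.prems(2) by (simp add: order_def)
    next
      case False
      then obtain d where d: "d \<in> D" "d \<notin> H"
        by blast
      then have dc: "d \<in> carrier G"
        using D by blast
      define K where "K = {x \<otimes> d [^] (e::nat) | x e. x \<in> H}"
      have K: "subgroup K G"
        unfolding K_def by (rule subgroup_adjoin_torsion[OF H dc exponent[OF dc] m])
      have "d = \<one> \<otimes> d [^] (1::nat)"
        using dc by simp
      then have "d \<in> K"
        unfolding K_def using subgroup.one_closed[OF H] by blast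
      moreover have "H \<subseteq> K"
      proof
        fix x assume "x \<in> H"
        moreover from this have "x = x \<otimes> d [^] (0::nat)"
          using Hc by auto
        ultimately show "x \<in> K"
          unfolding K_def by blast
      qed
      ultimately have HK: "H \<subset> K"
        using d by blast
      have finK: "finite K" and card_K: "card K \<le> order G"
        using fin K subgroup.subset[OF K] by (auto simp: order_def intro: finite_subset card_mono)
      have "card H < card K"
        using psubset_card_mono[OF finK HK] .
      have "K \<subseteq> sumset G ((m - 1) * big_omega (card K)) D"
      proof
        fix y assume "y \<in> K"
        then obtain x e where y: "x \<in> H" "y = x \<otimes> d [^] (e::nat)"
          by (auto simp: K_def)
        \<comment> \<open>Reducing the exponent modulo \<open>m\<close> leaves at most
          \<open>m - 1\<close> factors \<open>d\<close>.\<close>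
        have "d [^] e = d [^] (m * (e div m) + e mod m)"
          by simp
        also have "\<dots> = (d [^] m) [^] (e div m) \<otimes> d [^] (e mod m)"
          using dc by (simp only: nat_pow_mult nat_pow_pow)
        also have "\<dots> = d [^] (e mod m)"
          using dc exponent[OF dc] by simp
        finally have y': "y = x \<otimes> d [^] (e mod m)"
          using y by simp
        have "d [^] (e mod m) \<in> sumset G ((e mod m) * 1) D"
          by (rule sumset_nat_pow) (use D d sumset_1 in auto)
        then have "y \<in> sumset G ((m - 1) * big_omega (card H) + (e mod m) * 1) D"
          unfolding y' using y(1) less.prems(2) D by (intro sumset_add) auto
        moreover have "(m - 1) * big_omega (card H) + (e mod m) * 1 \<le> (m - 1) * big_omega (card K)"
        proof -
          have "e mod m \<le> m - 1"
            using m mod_less_divisor[of m e] by linarith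
          then have "(m - 1) * big_omega (card H) + (e mod m) * 1 \<le> (m - 1) * Suc (big_omega (card H))"
            by simp
          also have "\<dots> \<le> (m - 1) * big_omega (card K)"
            using big_omega_card_subgroup_less[OF fin H K HK] by (intro mult_le_mono2) simp
          finally show ?thesis .
        qed
        ultimately show "y \<in> sumset G ((m - 1) * big_omega (card K)) D"
          using sumset_mono[OF D] by blast
      qed
      then show ?thesis
        using less.hyps[OF _ K] \<open>card H < card K\<close> card_K by simp
    qed
  qed
  \<comment> \<open>The chain starts at the trivial subgroup, where Omega of 1 is 0 and the empty
    product is enough.\<close>
  from this[OF triv_subgroup] show ?thesis
    using D by (simp add: big_omega_def)
qed

text \<open>Translating by the inverse of some \<open>b\<close> in \<open>B\<close> puts the
  identity into the set, which the padding in the previous lemma requires. The translate still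
  covers the group with \<open>k\<close> factors.\<close>

lemma carrier_subset_sumset_of_exponent_of_basis:
  assumes fin: "finite (carrier G)" and m: "m \<ge> 1"
    and exponent: "\<And>x. x \<in> carrier G \<Longrightarrow> x [^] (m::nat) = \<one>"
    and B: "B \<subseteq> carrier G" "B \<noteq> {}" "carrier G \<subseteq> sumset G k B"
  shows "carrier G \<subseteq> sumset G ((m - 1) * big_omega (order G)) B"
proof -
  define r where "r = (m - 1) * big_omega (order G)"
  obtain b where b: "b \<in> B"
    using B by blast
  then have bc: "b \<in> carrier G"
    using B by blast
  define D where "D = (\<otimes>) (inv b) ` B"
  have D: "D \<subseteq> carrier G"
    using B bc by (auto simp: D_def)
  have shift: "(\<otimes>) c ` carrier G = carrier G" if "c \<in> carrier G" for c
    using that surj_const_mult by auto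
  have "sumset G k B = carrier G"
    using B sumset_subset_carrier by blast
  then have Dk: "sumset G k D = carrier G"
    using B bc by (simp add: D_def sumset_translate shift)
  have "carrier G \<subseteq> sumset G r D"
    unfolding r_def
  proof (rule carrier_subset_sumset_of_exponent[OF fin m exponent D])
    show "\<one> \<in> D"
      using b bc by (auto simp: D_def image_iff intro!: bexI[of _ b])
    \<comment> \<open>A subgroup containing \<open>D\<close> contains all products of
      \<open>k\<close> elements of \<open>D\<close>, hence everything.\<close>
    show "H = carrier G" if "subgroup H G" "D \<subseteq> H" for H
      using sumset_subset_subgroup[OF that, of k] Dk subgroup.subset[OF that(1)] by blast
  qed
  then have Dr: "sumset G r D = carrier G"
    using D sumset_subset_carrier by blast
  have "(\<otimes>) b ` D = B"
    using B bc by (force simp: D_def image_image m_assoc[symmetric] subset_iff)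
  then have "sumset G r B = (\<otimes>) (b [^] r) ` sumset G r D"
    using sumset_translate[OF D bc, of r] by simp
  then show ?thesis
    using Dr shift bc by (simp add: r_def)
qed

section \<open>The quotient by the multiples of m\<close>

lemma sumset_hom_image:
  assumes "comm_group K" "f \<in> hom G K" "A \<subseteq> carrier G"
  shows "sumset K k (f ` A) = f ` sumset G k A"
proof -
  interpret K: comm_group K by fact
  interpret group_hom G K f
    using assms by unfold_locales (simp_all add: hom_def)
  have fA: "f ` A \<subseteq> carrier K"
    using assms by auto
  show ?thesis
  proof (induction k)
    case (Suc k)
    have "f (a \<otimes> x) = f a \<otimes>\<^bsub>K\<^esub> f x" if "a \<in> A" "x \<in> sumset G k A" for a x
      using that assms sumset_subset_carrier by (intro hom_mult) auto
    then show ?case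
      unfolding K.sumset_Suc[OF fA] sumset_Suc[OF assms(3)] Suc
      by (auto simp: image_iff) metis
  qed simp
qed

lemma subgroup_multiples: "subgroup (multiples G m) G"
proof
  show "multiples G m \<subseteq> carrier G"
    by (auto simp: multiples_def)
  show "\<one> \<in> multiples G m"
    by (auto simp: multiples_def intro!: exI[of _ \<one>])
next
  fix x y assume "x \<in> multiples G m" "y \<in> multiples G m"
  then show "x \<otimes> y \<in> multiples G m"
    by (auto simp: multiples_def) (metis m_closed nat_pow_distrib)
next
  fix x assume "x \<in> multiples G m"
  then show "inv x \<in> multiples G m"
    by (auto simp: multiples_def) (metis inv_closed nat_pow_inv)
qed

lemma r_coset_multiples_eqD:
  assumes "x \<in> carrier G" "y \<in> carrier G" "multiples G m #> x = multiples G m #> y"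
  obtains z where "z \<in> carrier G" "x = z [^] m \<otimes> y"
proof -
  have "x \<in> multiples G m #> y"
    using assms(3) rcos_self[OF assms(1) subgroup_multiples[of m]] by simp
  then show ?thesis
    using that by (auto simp: r_coset_def multiples_def)
qed

text \<open>Every coset of \<open>multiples G m\<close> is infinite, hence meets the cofinite set \<open>sumset G k B\<close>.\<close>

lemma sumset_meets_coset_multiples:
  assumes inf: "infinite (carrier G)" and fin: "finite (carrier (G Mod multiples G m))"
    and m: "m \<ge> 1" and B: "B \<subseteq> carrier G" "B \<noteq> {}" and basis: "sumset G k B \<simeq> carrier G"
  shows "\<forall>x\<in>carrier G. \<exists>y\<in>sumset G ((m - 1) * big_omega (order (G Mod multiples G m))) B.
           multiples G m #> x = multiples G m #> y"
proof -
  define M where "M = multiples G m"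
  define Q where "Q = G Mod M"
  define p where "p = (\<lambda>x. M #> x)"
  have sub: "subgroup M G"
    unfolding M_def by (rule subgroup_multiples)
  then have "M \<lhd> G"
    using normal_iff_subgroup by blast
  then interpret M: normal M G .
  interpret Q: comm_group Q
    unfolding Q_def using sub by (rule abelian_FactGroup)
  have p: "p \<in> hom G Q"
    unfolding p_def Q_def by (rule M.r_coset_hom_Mod)
  have carrier_Q: "carrier Q = p ` carrier G"
    by (auto simp: Q_def FactGroup_def RCOSETS_def p_def)
  \<comment> \<open>The cosets are equinumerous and finite in number, so a single finite one would
    make the group finite.\<close>
  have inf_coset: "infinite (p x)" if "x \<in> carrier G" for x
  proof
    assume "finite (p x)"
    then have "finite M"
      using card_cosets_equal[of "p x" M] that subgroup.subset[OF sub] bij_betw_finite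
      unfolding p_def by (blast intro: rcosetsI)
    then have "finite c" if "c \<in> rcosets M" for c
      using that by (auto simp: RCOSETS_def r_coset_def)
    then have "finite (\<Union>(rcosets M))"
      using fin by (simp add: FactGroup_def M_def)
    then show False
      using inf rcosets_part_G[OF sub] by simp
  qed
  have Bk: "carrier Q \<subseteq> sumset Q k (p ` B)"
  proof
    fix c assume "c \<in> carrier Q"
    then obtain x where x: "x \<in> carrier G" "c = p x"
      using carrier_Q by auto
    have "finite (carrier G - sumset G k B)"
      using basis B by (simp add: almost_eq_superset_iff sumset_subset_carrier)
    then obtain y where y: "y \<in> p x" "y \<notin> carrier G - sumset G k B"
      using inf_coset[OF x(1)] by (meson finite_subset subsetI)
    have "p x \<subseteq> carrier G"
      unfolding p_def using x subgroup.subset[OF sub] by (intro r_coset_subset_G) auto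
    then have "y \<in> sumset G k B"
      using y by blast
    moreover have "p x = p y"
      using y(1) x(1) sub unfolding p_def by (intro repr_independence)
    ultimately show "c \<in> sumset Q k (p ` B)"
      using x sumset_hom_image[OF Q.comm_group_axioms p B(1)] by auto
  qed
  have exponent: "c [^]\<^bsub>Q\<^esub> m = \<one>\<^bsub>Q\<^esub>" if c: "c \<in> carrier Q" for c
  proof -
    obtain x where x: "x \<in> carrier G" "c = p x"
      using c carrier_Q by auto
    interpret ph: group_hom G Q p
      using p by unfold_locales
    have "x [^] m \<in> M"
      using x(1) unfolding M_def multiples_def by blast
    then have "p (x [^] m) = M"
      unfolding p_def using x sub by (simp add: coset_join2)
    moreover have "c [^]\<^bsub>Q\<^esub> m = p (x [^] m)"
      using x by (simp add: ph.hom_nat_pow)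
    ultimately show ?thesis
      by (simp add: Q_def FactGroup_def)
  qed
  have "carrier Q \<subseteq> sumset Q ((m - 1) * big_omega (order Q)) (p ` B)"
  proof (rule Q.carrier_subset_sumset_of_exponent_of_basis[OF _ m exponent _ _ Bk])
    show "finite (carrier Q)"
      using fin by (simp add: Q_def M_def)
    show "p ` B \<subseteq> carrier Q"
      using B carrier_Q by auto
  qed (use B in auto)
  then have "p ` carrier G \<subseteq> p ` sumset G ((m - 1) * big_omega (order Q)) B"
    unfolding sumset_hom_image[OF Q.comm_group_axioms p B(1)] carrier_Q .
  then show ?thesis
    unfolding p_def Q_def M_def by blast
qed

section \<open>Two lengths for one element, and the final bound\<close>

text \<open>Along the progression \<open>x, x \<otimes> b, x \<otimes> b [^] 2, \<dots>\<close> the number of factors, being confined to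
  \<open>{1..h}\<close>, cannot increase \<open>h\<close> times in a row.\<close>

lemma exists_two_lengths:
  assumes inf: "infinite (carrier G)" and B: "B \<subseteq> carrier G" "b \<in> B"
    and E: "finite E" "\<And>x. x \<in> carrier G - E \<Longrightarrow> \<exists>i\<in>{1..h}. x \<in> sumset G i B"
  obtains c s m where "1 \<le> m" "m \<le> h" "s + m \<le> h + 1"
    "c \<in> sumset G s B" "c \<in> sumset G (s + m) B"
proof -
  have b: "b \<in> carrier G"
    using B by blast
  \<comment> \<open>These are the starting points whose progression meets \<open>E\<close> within
    its first \<open>h + 1\<close> terms.\<close>
  define bad where "bad = (\<Union>j\<in>{..h}. (\<lambda>e. e \<otimes> inv (b [^] j)) ` E)"
  have "finite bad"
    using E by (auto simp: bad_def)
  then obtain x where x: "x \<in> carrier G" "x \<notin> bad"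
    using inf by (meson finite_subset subsetI)
  have "\<exists>i\<in>{1..h}. x \<otimes> b [^] j \<in> sumset G i B" if "j \<le> h" for j
  proof (rule E(2))
    have "x = (x \<otimes> b [^] j) \<otimes> inv (b [^] j)"
      using x b by (simp add: m_assoc)
    then show "x \<otimes> b [^] j \<in> carrier G - E"
      using x b that by (auto simp: bad_def)
  qed
  then obtain l where l: "\<And>j. j \<le> h \<Longrightarrow> l j \<in> {1..h} \<and> x \<otimes> b [^] j \<in> sumset G (l j) B"
    by metis
  have "\<exists>j<h. l (Suc j) \<le> l j"
  proof (rule ccontr)
    assume "\<not> ?thesis"
    then have incr: "l j < l (Suc j)" if "j < h" for j
      using that by auto
    have "j \<le> h \<Longrightarrow> l j \<ge> Suc j" for j
    proof (induction j)
      case 0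
      then show ?case
        using l[of 0] by auto
    next
      case (Suc j)
      then show ?case
        using incr[of j] by auto
    qed
    from this[of h] l[of h] show False
      by simp
  qed
  then obtain j where j: "j < h" "l (Suc j) \<le> l j"
    by blast
  have lj: "l j \<in> {1..h}" "x \<otimes> b [^] j \<in> sumset G (l j) B"
    using l[of j] j by auto
  have lj': "l (Suc j) \<in> {1..h}" "x \<otimes> b [^] Suc j \<in> sumset G (l (Suc j)) B"
    using l[of "Suc j"] j by auto
  \<comment> \<open>Appending \<open>b\<close> gives the next term the length \<open>l j + 1\<close>
    besides \<open>l (Suc j)\<close>. The difference is at least 1 as \<open>l\<close> does not
    increase at \<open>j\<close>, and at most \<open>h\<close> as \<open>l j\<close> is at most
    \<open>h\<close> and \<open>l (Suc j)\<close> at least 1.\<close>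
  have "(x \<otimes> b [^] j) \<otimes> b \<in> sumset G (l j + Suc 0) B"
    using B lj by (intro sumset_add) (auto simp: sumset_1)
  moreover have "(x \<otimes> b [^] j) \<otimes> b = x \<otimes> b [^] Suc j"
    using x b by (simp add: m_assoc)
  ultimately have "x \<otimes> b [^] Suc j \<in> sumset G (l (Suc j) + (l j + 1 - l (Suc j))) B"
    using j by simp
  then show ?thesis
    using that[of "l j + 1 - l (Suc j)" "l (Suc j)" "x \<otimes> b [^] Suc j"] lj lj' j by auto
qed

text \<open>The assumption on \<open>k\<close> enters only qualitatively, making \<open>B\<close>
  nonempty and its image cover the quotient; the value of \<open>k\<close> does not affect the
  bound.\<close>

lemma ord_star_remove_one_le:
  assumes inf: "infinite (carrier G)" and "h \<ge> 1"
    and fin: "\<And>m. 1 \<le> m \<Longrightarrow> m \<le> h \<Longrightarrow> finite (carrier (G Mod multiples G m))"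
    and B: "B \<subseteq> carrier G" and hA: "sumset G h (insert \<one> B) \<simeq> carrier G"
    and basis: "sumset G k B \<simeq> carrier G" "k \<ge> 1"
  shows "ord_star G B \<le> enat (h\<^sup>2 + h * (MAX m\<in>{1..h}. big_omega (order (G Mod multiples G m))) + h - 1)"
proof -
  have "B \<noteq> {}"
  proof
    assume "B = {}"
    then have "sumset G k B = {}"
      using basis(2) by (cases k) (auto simp: sumset_Suc)
    then show False
      using basis(1) inf by (simp add: almost_eq_def)
  qed
  then obtain b where b: "b \<in> B"
    by blast
  \<comment> \<open>The identity counts as exceptional because it is the empty product; any other
    element has length at least 1.\<close>
  define E where "E = insert \<one> (carrier G - sumset G h (insert \<one> B))"
  have finE: "finite E"
    using hA B by (simp add: E_def almost_eq_superset_iff sumset_subset_carrier)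
  have E: "\<exists>i\<in>{1..h}. x \<in> sumset G i B" if x: "x \<in> carrier G - E" for x
  proof -
    have "x \<in> sumset G h (insert \<one> B)" "x \<noteq> \<one>"
      using x by (auto simp: E_def)
    then obtain i where i: "i \<le> h" "x \<in> sumset G i B"
      using sumset_insert_one[OF B] by blast
    have "i \<noteq> 0"
      using i(2) \<open>x \<noteq> \<one>\<close> by (intro notI) simp
    then show ?thesis
      using i by auto
  qed
  from exists_two_lengths[OF inf B b finE E] obtain c s m where m: "1 \<le> m" "m \<le> h" "s + m \<le> h + 1"
    and c: "c \<in> sumset G s B" "c \<in> sumset G (s + m) B"
    by blast
  have cc: "c \<in> carrier G"
    using c B sumset_subset_carrier by blast
  define M where "M = multiples G m"
  define w where "w = big_omega (order (G Mod M))"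
  define r where "r = (m - 1) * w"
  have "\<forall>x\<in>carrier G. \<exists>y\<in>sumset G r B. M #> x = M #> y"
    using sumset_meets_coset_multiples[OF inf fin[OF m(1,2)] m(1) B \<open>B \<noteq> {}\<close> basis(1)]
    by (simp add: M_def r_def w_def)
  moreover have "finite ((\<lambda>x. M #> x) ` carrier G)"
    using fin[OF m(1,2)] by (simp add: M_def FactGroup_def RCOSETS_def UNION_singleton_eq_range)
  moreover have "(\<lambda>x. M #> x) ` carrier G \<subseteq> (\<lambda>x. M #> x) ` sumset G r B"
    using calculation(1) by blast
  \<comment> \<open>Finitely many representatives are fixed so that \<open>bad\<close> below is
    finite.\<close>
  ultimately obtain F where F: "finite F" "F \<subseteq> sumset G r B"
    "(\<lambda>x. M #> x) ` carrier G = (\<lambda>x. M #> x) ` F"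
    by (meson finite_subset_image)
  define N where "N = r + (m * h + (h - 1) * s)"
  define bad where "bad = (\<lambda>(z, f). z [^] m \<otimes> f \<otimes> c [^] (h - 1)) ` (E \<times> F)"
  have "carrier G - sumset G N B \<subseteq> bad"
  proof
    fix x assume x: "x \<in> carrier G - sumset G N B"
    \<comment> \<open>The copies of \<open>c\<close> are split off first, so that the representative
      \<open>f\<close> is chosen for the coset of what remains.\<close>
    define y where "y = x \<otimes> inv (c [^] (h - 1))"
    have y: "y \<in> carrier G"
      using x cc by (simp add: y_def)
    then obtain f where f: "f \<in> F" "M #> y = M #> f"
      using F(3) by blast
    have fc: "f \<in> carrier G"
      using f(1) F(2) sumset_subset_carrier[OF B, of r] by blast
    from r_coset_multiples_eqD[OF y fc] f(2) obtain z where z: "z \<in> carrier G" "y = z [^] m \<otimes> f"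
      unfolding M_def by blast
    have xz: "x = z [^] m \<otimes> f \<otimes> c [^] (h - 1)"
      unfolding z(2)[symmetric] y_def using x cc by (simp add: m_assoc)
    have "z \<in> E"
    proof (rule ccontr)
      assume "z \<notin> E"
      then obtain i where i: "1 \<le> i" "i \<le> h" "z \<in> sumset G i B"
        using E[of z] z by auto
      \<comment> \<open>As \<open>i\<close> is at least 1, the \<open>h - i\<close> longer
        representations fit among \<open>h - 1\<close> copies of \<open>c\<close>.\<close>
      have "c [^] (h - 1) \<in> sumset G ((h - 1) * s + (h - i) * m) B"
        using i by (intro nat_pow_mem_sumset_interpolate[OF B c]) auto
      then have "x \<in> sumset G (m * i + r + ((h - 1) * s + (h - i) * m)) B"
        unfolding xz using i f F by (intro sumset_add sumset_nat_pow B) auto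
      moreover have "m * i + r + ((h - 1) * s + (h - i) * m) = N"
      proof -
        have "m * h = m * i + (h - i) * m"
          using i by (simp add: algebra_simps flip: add_mult_distrib2)
        then show ?thesis
          by (simp add: N_def)
      qed
      ultimately show False
        using x by simp
    qed
    then show "x \<in> bad"
      using xz f(1) by (force simp: bad_def)
  qed
  moreover have "finite bad"
    using finE F by (simp add: bad_def)
  ultimately have "sumset G N B \<simeq> carrier G"
    using B by (simp add: almost_eq_superset_iff sumset_subset_carrier finite_subset)
  moreover have "N \<ge> 1"
    using m \<open>h \<ge> 1\<close> by (simp add: N_def Suc_le_eq)
  ultimately have "ord_star G B \<le> enat N"
    by (rule ord_star_le[rotated])
  also have "N \<le> h\<^sup>2 + h * (MAX m\<in>{1..h}. big_omega (order (G Mod multiples G m))) + h - 1"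
  proof -
    have "w \<le> (MAX m\<in>{1..h}. big_omega (order (G Mod multiples G m)))"
      unfolding w_def M_def by (rule Max_ge) (use m in auto)
    then have "r \<le> h * (MAX m\<in>{1..h}. big_omega (order (G Mod multiples G m)))"
      unfolding r_def using m by (intro mult_le_mono) auto
    moreover have "m * h + (h - 1) * s \<le> h\<^sup>2 + h - 1"
    proof -
      obtain n where n: "h = Suc n"
        using \<open>h \<ge> 1\<close> by (cases h) auto
      \<comment> \<open>Regrouping brings in \<open>s + m\<close>, whose bound \<open>h + 1\<close>
        is sharper than separate bounds on \<open>s\<close> and \<open>m\<close>.\<close>
      have "m * h + (h - 1) * s = m + n * (s + m)"
        by (simp add: n algebra_simps)
      also have "\<dots> \<le> h + n * (h + 1)"
        using m by (intro add_mono[OF _ mult_le_mono2]) auto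
      also have "\<dots> = h\<^sup>2 + h - 1"
        by (simp add: n power2_eq_square algebra_simps)
      finally show ?thesis .
    qed
    ultimately show ?thesis
      using \<open>h \<ge> 1\<close> by (simp add: N_def)
  qed
  finally show ?thesis
    by simp
qed

end

theorem theorem1p3:
  fixes G :: "('a, 'b) monoid_scheme" and h :: nat
  assumes "comm_group G"
    and "infinite (carrier G)"
    and "h \<ge> 1"
    and "\<And>m. 1 \<le> m \<Longrightarrow> m \<le> h \<Longrightarrow> finite (carrier (G Mod multiples G m))"
  shows "X_fun G h \<le> enat (h\<^sup>2 + h * (MAX m\<in>{1..h}. big_omega (order (G Mod multiples G m))) + h - 1)"
proof -
  interpret comm_group G by fact
  let ?bound = "enat (h\<^sup>2 + h * (MAX m\<in>{1..h}. big_omega (order (G Mod multiples G m))) + h - 1)"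
  have "ord_star G (A - {a}) \<le> ?bound"
    if A: "A \<subseteq> carrier G" "sumset G h A \<simeq> carrier G" and a: "a \<in> regular_elements G A" for A a
  proof -
    have aA: "a \<in> A" and "ord_star G (A - {a}) < \<infinity>"
      using a by (auto simp: regular_elements_def additive_basis_def)
    then obtain k where k: "k \<ge> 1" "sumset G k (A - {a}) \<simeq> carrier G"
      by (auto simp: ord_star_def split: if_splits)
    have ac: "a \<in> carrier G"
      using aA A by blast
    \<comment> \<open>This translation carries \<open>a\<close> to the identity and changes neither
      cofiniteness nor \<open>ord_star\<close>.\<close>
    define B where "B = (\<otimes>\<^bsub>G\<^esub>) (inv\<^bsub>G\<^esub> a) ` (A - {a})"
    have "insert a (A - {a}) = A"
      using aA by blast
    then have "insert \<one>\<^bsub>G\<^esub> B = (\<otimes>\<^bsub>G\<^esub>) (inv\<^bsub>G\<^esub> a) ` A"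
      using ac unfolding B_def by (metis image_insert l_inv)
    then have "sumset G h (insert \<one>\<^bsub>G\<^esub> B) \<simeq> carrier G"
      using A ac by (simp add: sumset_translate_almost_eq_iff)
    moreover have Aa: "A - {a} \<subseteq> carrier G"
      using A by blast
    then have "sumset G k B \<simeq> carrier G"
      unfolding B_def using k(2) ac by (simp add: sumset_translate_almost_eq_iff)
    moreover have "B \<subseteq> carrier G"
      using Aa ac by (auto simp: B_def)
    ultimately have "ord_star G B \<le> ?bound"
      using ord_star_remove_one_le[OF assms(2,3,4)] k(1) by blast
    then show ?thesis
      using ord_star_translate[OF Aa] ac by (simp add: B_def)
  qed
  then show ?thesis
    unfolding X_fun_def by (intro Sup_least) blast
qed

end
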